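(* Let $G$ be a finite group, $H\le G$ a subgroup and $w$ a weight on $G$ (possibly reducible). The left-invariant random walk driven by $w$ (i) lumps strongly to $G/H$ if and only if $w(gH)$ is constant for left cosets $gH$ in the same double coset (that is, $w(gH)=w(g'H)$ whenever $HgH=Hg'H$); (ii) lumps exactly to $G/H$ if and only if $w(Hg)$ is constant for right cosets $Hg$ in the same double coset (that is, $w(Hg)=w(Hg')$ whenever $HgH=Hg'H$).
   Context: A weight on $G$ is a function $w:G\to\mathbb{R}_{\ge0}$, not identically zero; $w(K)=\sum_{g\in K}w(g)$ for $K\subseteq G$. The left-invariant random walk driven by $w$ has transition matrix $P(x,y)=w(x^{-1}y)/w(G)$ on $G$, acting on the right on row vectors in $\mathbb{R}^G$. Let $f:G\to G/H$, $g\mapsto gH$. Strong lumping: a stochastic matrix $P$ on a finite set $A$ lumps strongly under a surjection $f:A\to B$ if whenever $f(a)=f(a')$, $\sum_{x\in f^{-1}(b)}P(a,x)=\sum_{x\in f^{-1}(b)}P(a',x)$ for every $b\in B$. Exact lumping: for a probability distribution $\alpha$ on $A$, let $V(f,P,\alpha)$ be the minimal subspace $V\subseteq\mathbb{R}^A$ with $\alpha\in V$, $VP\subseteq V$ and $V\Pi_b\subseteq V$ for all $b\in B$, where $\Pi_b$ is the coordinate projection of $\mathbb{R}^A$ onto $\mathbb{R}^{f^{-1}(b)}$. $\mathrm{MC}(\alpha,P)$ lumps exactly under $f$ if the only $v\in V(f,P,\alpha)$ with $\sum_{a\in f^{-1}(b)}v(a)=0$ for all $b\in B$ is $v=0$.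 The left-invariant random walk driven by $w$ lumps strongly (respectively exactly) to $G/H$ if its transition matrix $P$ lumps strongly under $f$ (respectively if $\mathrm{MC}(\eta_G,P)$ lumps exactly under $f$, where $\eta_G$ is the uniform distribution on $G$). *)

theory Defs
  imports Complex_Main "HOL-Library.Function_Algebras" "HOL-Algebra.Left_Coset"
begin

section \<open>Row vectors indexed by a finite set\<close>

text \<open>The space of real vectors indexed by a set A is realised as the set of functions that vanish
  outside A. This is faithful: two such functions are equal iff they agree on A.\<close>

definition fun_scale :: "real \<Rightarrow> ('a \<Rightarrow> real) \<Rightarrow> 'a \<Rightarrow> real"
  where "fun_scale c v = (\<lambda>x. c * v x)"

interpretation fun_vs: vector_space "fun_scale :: real \<Rightarrow> ('a \<Rightarrow> real) \<Rightarrow> 'a \<Rightarrow> real"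
  by unfold_locales (auto simp: fun_scale_def fun_eq_iff algebra_simps)

definition vecs :: "'a set \<Rightarrow> ('a \<Rightarrow> real) set"
  where "vecs A = {v. \<forall>x. x \<notin> A \<longrightarrow> v x = 0}"

definition vec_mat :: "'a set \<Rightarrow> ('a \<Rightarrow> real) \<Rightarrow> ('a \<Rightarrow> 'a \<Rightarrow> real) \<Rightarrow> 'a \<Rightarrow> real"
  where "vec_mat A v P = (\<lambda>y. if y \<in> A then \<Sum>x\<in>A. v x * P x y else 0)"

definition fiber :: "'a set \<Rightarrow> ('a \<Rightarrow> 'b) \<Rightarrow> 'b \<Rightarrow> 'a set"
  where "fiber A f b = {a \<in> A. f a = b}"

definition coord_proj :: "'a set \<Rightarrow> ('a \<Rightarrow> real) \<Rightarrow> 'a \<Rightarrow> real"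
  where "coord_proj S v = (\<lambda>x. if x \<in> S then v x else 0)"

definition stochastic :: "'a set \<Rightarrow> ('a \<Rightarrow> 'a \<Rightarrow> real) \<Rightarrow> bool"
  where "stochastic A P \<longleftrightarrow>
    (\<forall>x\<in>A. \<forall>y\<in>A. 0 \<le> P x y) \<and> (\<forall>x\<in>A. (\<Sum>y\<in>A. P x y) = 1)"

definition distribution_on :: "'a set \<Rightarrow> ('a \<Rightarrow> real) \<Rightarrow> bool"
  where "distribution_on A \<alpha> \<longleftrightarrow> \<alpha> \<in> vecs A \<and> (\<forall>x\<in>A. 0 \<le> \<alpha> x) \<and> (\<Sum>x\<in>A. \<alpha> x) = 1"

definition uniform_on :: "'a set \<Rightarrow> 'a \<Rightarrow> real"
  where "uniform_on A = (\<lambda>x. if x \<in> A then 1 / real (card A) else 0)"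

section \<open>Strong and exact lumping\<close>

text \<open>In this section A is a finite set, f maps A onto B, P is a stochastic matrix on A
  and \<open>\<alpha>\<close> is a probability distribution on A. That the random walk below meets these
  conditions is proved at the end.\<close>

definition lumps_strongly ::
    "'a set \<Rightarrow> 'b set \<Rightarrow> ('a \<Rightarrow> 'b) \<Rightarrow> ('a \<Rightarrow> 'a \<Rightarrow> real) \<Rightarrow> bool"
  where "lumps_strongly A B f P \<longleftrightarrow>
    (\<forall>a\<in>A. \<forall>a'\<in>A. f a = f a' \<longrightarrow>
      (\<forall>b\<in>B. (\<Sum>x\<in>fiber A f b. P a x) = (\<Sum>x\<in>fiber A f b. P a' x)))"

definition lump_invariant ::
    "'a set \<Rightarrow> 'b set \<Rightarrow> ('a \<Rightarrow> 'b) \<Rightarrow> ('a \<Rightarrow> 'a \<Rightarrow> real) \<Rightarrow> ('a \<Rightarrow> real) set \<Rightarrow> bool"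
  where "lump_invariant A B f P V \<longleftrightarrow>
    fun_vs.subspace V \<and> V \<subseteq> vecs A \<and>
    (\<forall>v\<in>V. vec_mat A v P \<in> V) \<and>
    (\<forall>b\<in>B. \<forall>v\<in>V. coord_proj (fiber A f b) v \<in> V)"

text \<open>The minimal subspace is the intersection of all candidates; see
  \<open>lump_space_least\<close>.\<close>

definition lump_space ::
    "'a set \<Rightarrow> 'b set \<Rightarrow> ('a \<Rightarrow> 'b) \<Rightarrow> ('a \<Rightarrow> 'a \<Rightarrow> real) \<Rightarrow> ('a \<Rightarrow> real) \<Rightarrow> ('a \<Rightarrow> real) set"
  where "lump_space A B f P \<alpha> = \<Inter> {V. lump_invariant A B f P V \<and> \<alpha> \<in> V}"

definition lumps_exactly ::
    "'a set \<Rightarrow> 'b set \<Rightarrow> ('a \<Rightarrow> 'b) \<Rightarrow> ('a \<Rightarrow> real) \<Rightarrow> ('a \<Rightarrow> 'a \<Rightarrow> real) \<Rightarrow> bool"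
  where "lumps_exactly A B f \<alpha> P \<longleftrightarrow>
    (\<forall>v\<in>lump_space A B f P \<alpha>. (\<forall>b\<in>B. (\<Sum>a\<in>fiber A f b. v a) = 0) \<longrightarrow> v = 0)"

lemma lump_invariant_vecs: "lump_invariant A B f P (vecs A)"
  by (auto simp: lump_invariant_def fun_vs.subspace_def vecs_def vec_mat_def coord_proj_def
      fun_scale_def fiber_def)

lemma lump_space_least:
  assumes "\<alpha> \<in> vecs A"
  shows "lump_invariant A B f P (lump_space A B f P \<alpha>)"
    and "\<alpha> \<in> lump_space A B f P \<alpha>"
    and "\<And>V. lump_invariant A B f P V \<Longrightarrow> \<alpha> \<in> V \<Longrightarrow> lump_space A B f P \<alpha> \<subseteq> V"
proof -
  have "lump_space A B f P \<alpha> \<subseteq> vecs A"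
    using assms lump_invariant_vecs unfolding lump_space_def by blast
  moreover have "fun_vs.subspace (lump_space A B f P \<alpha>)"
    unfolding lump_space_def by (rule fun_vs.subspace_Inter) (auto simp: lump_invariant_def)
  ultimately show "lump_invariant A B f P (lump_space A B f P \<alpha>)"
    unfolding lump_invariant_def by (auto simp: lump_space_def lump_invariant_def)
  show "\<alpha> \<in> lump_space A B f P \<alpha>"
    by (auto simp: lump_space_def)
  show "\<And>V. lump_invariant A B f P V \<Longrightarrow> \<alpha> \<in> V \<Longrightarrow> lump_space A B f P \<alpha> \<subseteq> V"
    by (auto simp: lump_space_def)
qed

section \<open>Left-invariant random walks on a finite group\<close>

definition weight :: "('a, 'c) monoid_scheme \<Rightarrow> ('a \<Rightarrow> real) \<Rightarrow> bool"
  where "weight G w \<longleftrightarrow> (\<forall>g\<in>carrier G. 0 \<le> w g) \<and> (\<exists>g\<in>carrier G. w g \<noteq> 0)"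

definition walk_matrix :: "('a, 'c) monoid_scheme \<Rightarrow> ('a \<Rightarrow> real) \<Rightarrow> 'a \<Rightarrow> 'a \<Rightarrow> real"
  where "walk_matrix G w x y = w (inv\<^bsub>G\<^esub> x \<otimes>\<^bsub>G\<^esub> y) / sum w (carrier G)"

definition walk_lumps_strongly ::
    "('a, 'c) monoid_scheme \<Rightarrow> 'a set \<Rightarrow> ('a \<Rightarrow> real) \<Rightarrow> bool"
  where "walk_lumps_strongly G H w \<longleftrightarrow>
    lumps_strongly (carrier G) (lcosets\<^bsub>G\<^esub> H) (\<lambda>g. g <#\<^bsub>G\<^esub> H) (walk_matrix G w)"

definition walk_lumps_exactly ::
    "('a, 'c) monoid_scheme \<Rightarrow> 'a set \<Rightarrow> ('a \<Rightarrow> real) \<Rightarrow> bool"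
  where "walk_lumps_exactly G H w \<longleftrightarrow>
    lumps_exactly (carrier G) (lcosets\<^bsub>G\<^esub> H) (\<lambda>g. g <#\<^bsub>G\<^esub> H)
      (uniform_on (carrier G)) (walk_matrix G w)"

definition double_coset :: "('a, 'c) monoid_scheme \<Rightarrow> 'a set \<Rightarrow> 'a \<Rightarrow> 'a set"
  where "double_coset G H g = (H #>\<^bsub>G\<^esub> g) <#>\<^bsub>G\<^esub> H"

lemma lcoset_map_surj: "(\<lambda>g. g <#\<^bsub>G\<^esub> H) ` carrier G = lcosets\<^bsub>G\<^esub> H"
  by (auto simp: LCOSETS_def)

lemma stochastic_walk_matrix:
  fixes G (structure)
  assumes "group G" "finite (carrier G)" "weight G w"
  shows "stochastic (carrier G) (walk_matrix G w)"
proof -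
  interpret group G by fact
  have nonneg: "\<And>g. g \<in> carrier G \<Longrightarrow> 0 \<le> w g"
    using assms(3) by (simp add: weight_def)
  then have "sum w (carrier G) \<noteq> 0"
    using assms(2,3) by (auto simp: weight_def sum_nonneg_eq_0_iff)
  moreover have "(\<Sum>y\<in>carrier G. w (inv x \<otimes> y)) = sum w (carrier G)" if "x \<in> carrier G" for x
  proof (rule sum.reindex_bij_witness[where i = "\<lambda>y. x \<otimes> y" and j = "\<lambda>y. inv x \<otimes> y"])
  qed (use that in \<open>auto simp flip: m_assoc\<close>)
  ultimately show ?thesis
    using nonneg by (auto simp: stochastic_def walk_matrix_def sum_nonneg simp flip: sum_divide_distrib)
qed

lemma distribution_uniform_on:
  assumes "finite A" "A \<noteq> {}"
  shows "distribution_on A (uniform_on A)"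
  using assms by (auto simp: distribution_on_def uniform_on_def vecs_def)

end

theory Submission
  imports Defs
begin

text \<open>Two elements lie in the same double coset exactly when one arises from the other by
  multiplying with elements of \<open>H\<close> on both sides
  (\<open>constant_on_double_cosets_iff\<close>). Since \<open>w(gH)\<close> never changes when \<open>g\<close> is multiplied by \<open>H\<close> on
  the right, the condition in the first part says that it does not change under \<open>H\<close> on the left;
  symmetrically, the condition in the second part says that \<open>w(Hg)\<close> does not change when \<open>g\<close> is
  multiplied by \<open>H\<close> on the right.

  For strong lumping, the walk started at \<open>a\<close> enters \<open>yH\<close> with probability
  \<open>w(a\<^sup>-\<^sup>1yH)/w(G)\<close>, and replacing \<open>a\<close> by another point \<open>ah\<close> of its coset
  replaces this by \<open>w(h\<^sup>-\<^sup>1a\<^sup>-\<^sup>1yH)/w(G)\<close>. So strong lumping is invariance of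
  \<open>w(gH)\<close> under \<open>H\<close> on the left (\<open>walk_lumps_strongly_iff\<close>).

  For exact lumping (\<open>walk_lumps_exactly_iff\<close>), the minimal space contains the uniform
  distribution on every left coset. Starting from the one on \<open>H\<close>, one step of the walk gives
  \<open>y\<close> a mass proportional to \<open>w(Hy)\<close>. Cutting this vector down to a coset \<open>gH\<close> and subtracting
  its mean there gives a vector of the minimal space with all coset sums zero; exact lumping forces
  it to vanish, so \<open>w(Hy)\<close> is constant on \<open>gH\<close>. Conversely, if \<open>w(Hy)\<close> is constant on left
  cosets, then so is \<open>vP\<close> for every \<open>v\<close> that is constant on left cosets: averaging over \<open>H\<close> lets
  \<open>w\<close> enter \<open>vP\<close> only through its right coset sums
  (\<open>card_times_sum_right_invariant\<close>). The vectors constant on left cosets thus form an invariant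
  space (\<open>lump_invariant_right_invariant_vecs\<close>), which contains the minimal one, and such a vector
  is determined by its coset sums.\<close>

context group
begin

section \<open>Cosets and double cosets\<close>

lemma sum_rcoset:
  assumes "subgroup H G" "g \<in> carrier G"
  shows "sum w (H #> g) = (\<Sum>h\<in>H. w (h \<otimes> g))"
proof -
  have "H #> g = (\<lambda>h. h \<otimes> g) ` H"
    by (auto simp: r_coset_def)
  moreover have "inj_on (\<lambda>h. h \<otimes> g) H"
    using assms subgroup.mem_carrier[OF assms(1)] by (simp add: inj_on_def)
  ultimately show ?thesis
    by (simp add: sum.reindex)
qed

lemma fiber_lcoset_map:
  assumes "subgroup H G" "y \<in> carrier G"
  shows "fiber (carrier G) (\<lambda>g. g <# H) (y <# H) = y <# H"
proof -
  have "a <# H = y <# H \<longleftrightarrow> a \<in> y <# H" if "a \<in> carrier G" for a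
    using that assms lcos_self l_repr_independence by blast
  then show ?thesis
    using l_coset_subset_G[OF subgroup.subset[OF assms(1)] assms(2)] by (auto simp: fiber_def)
qed

lemma lcoset_eq_iff:
  assumes "subgroup H G" "a \<in> carrier G" "a' \<in> carrier G"
  shows "a <# H = a' <# H \<longleftrightarrow> (\<exists>h\<in>H. a' = a \<otimes> h)"
proof -
  have "a <# H = a' <# H \<longleftrightarrow> a' \<in> a <# H"
    using assms lcos_self l_repr_independence by blast
  then show ?thesis
    by (auto simp: l_coset_def)
qed

lemma double_coset_eq_iff:
  assumes "subgroup H G" "g \<in> carrier G" "g' \<in> carrier G"
  shows "double_coset G H g = double_coset G H g' \<longleftrightarrow> (\<exists>h\<in>H. \<exists>k\<in>H. g' = h \<otimes> g \<otimes> k)"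
proof -
  interpret H: subgroup H G by fact
  have dc: "double_coset G H x = {h \<otimes> x \<otimes> k |h k. h \<in> H \<and> k \<in> H}" for x
    by (auto simp: double_coset_def set_mult_def r_coset_def)
  show ?thesis
  proof
    assume eq: "double_coset G H g = double_coset G H g'"
    have "g' = \<one> \<otimes> g' \<otimes> \<one>"
      using assms by simp
    then have "g' \<in> double_coset G H g'"
      unfolding dc using H.one_closed by blast
    then show "\<exists>h\<in>H. \<exists>k\<in>H. g' = h \<otimes> g \<otimes> k"
      unfolding eq[symmetric] unfolding dc by blast
  next
    assume "\<exists>h\<in>H. \<exists>k\<in>H. g' = h \<otimes> g \<otimes> k"
    then obtain h k where hk: "h \<in> H" "k \<in> H" "g' = h \<otimes> g \<otimes> k"
      by blast
    have sub: "double_coset G H (a \<otimes> x \<otimes> b) \<subseteq> double_coset G H x"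
      if "a \<in> H" "b \<in> H" "x \<in> carrier G" for a b x
    proof -
      have "c \<otimes> (a \<otimes> x \<otimes> b) \<otimes> d = (c \<otimes> a) \<otimes> x \<otimes> (b \<otimes> d)" if "c \<in> H" "d \<in> H" for c d
        using \<open>a \<in> H\<close> \<open>b \<in> H\<close> \<open>x \<in> carrier G\<close> that by (simp add: m_assoc)
      then show ?thesis
        unfolding dc using \<open>a \<in> H\<close> \<open>b \<in> H\<close> H.m_closed by blast
    qed
    have "g = inv h \<otimes> g' \<otimes> inv k"
      using hk assms(2) by (simp add: m_assoc) (simp flip: m_assoc)
    then have "double_coset G H g \<subseteq> double_coset G H g'"
      using sub[of "inv h" "inv k" g'] hk assms by simp
    moreover have "double_coset G H g' \<subseteq> double_coset G H g"
      using sub[of h k g] hk assms by simp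
    ultimately show "double_coset G H g = double_coset G H g'"
      by blast
  qed
qed

text \<open>A double coset is an orbit of \<open>H\<close> acting from both sides, so being constant on double cosets
  can be tested on each side separately. A coset sum has one of the two invariances for free, and the
  two lemmas that follow keep the other.\<close>

lemma constant_on_double_cosets_iff:
  assumes "subgroup H G"
  shows "(\<forall>g\<in>carrier G. \<forall>g'\<in>carrier G. double_coset G H g = double_coset G H g' \<longrightarrow> F g = F g') \<longleftrightarrow>
         (\<forall>h\<in>H. \<forall>g\<in>carrier G. F (h \<otimes> g) = F g \<and> F (g \<otimes> h) = F g)"
    (is "?L \<longleftrightarrow> ?R")
proof -
  interpret H: subgroup H G by fact
  show ?thesis
  proof
    assume L: ?L
    show ?R
    proof (intro ballI)
      fix h g assume hg: "h \<in> H" "g \<in> carrier G"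
      then have "\<exists>a\<in>H. \<exists>k\<in>H. h \<otimes> g = a \<otimes> g \<otimes> k" "\<exists>a\<in>H. \<exists>k\<in>H. g \<otimes> h = a \<otimes> g \<otimes> k"
        by (intro bexI[of _ h] bexI[of _ \<one>]; simp)+
      then have "double_coset G H g = double_coset G H (h \<otimes> g)"
        "double_coset G H g = double_coset G H (g \<otimes> h)"
        using hg assms double_coset_eq_iff by simp_all
      then show "F (h \<otimes> g) = F g \<and> F (g \<otimes> h) = F g"
        using L hg by (metis H.mem_carrier m_closed)
    qed
  next
    assume R: ?R
    show ?L
    proof (intro ballI impI)
      fix g g' assume g: "g \<in> carrier G" "g' \<in> carrier G"
        and "double_coset G H g = double_coset G H g'"
      then obtain h k where "h \<in> H" "k \<in> H" "g' = h \<otimes> g \<otimes> k"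
        using assms by (auto simp: double_coset_eq_iff)
      then show "F g = F g'"
        using R g by simp
    qed
  qed
qed

lemma lcoset_weight_constant_iff:
  assumes "subgroup H G"
  shows "(\<forall>g\<in>carrier G. \<forall>g'\<in>carrier G. double_coset G H g = double_coset G H g' \<longrightarrow>
             sum w (g <# H) = sum w (g' <# H)) \<longleftrightarrow>
         (\<forall>h\<in>H. \<forall>g\<in>carrier G. sum w (h \<otimes> g <# H) = sum w (g <# H))"
proof -
  interpret H: subgroup H G by fact
  have "g \<otimes> h <# H = g <# H" if "h \<in> H" "g \<in> carrier G" for g h
    using lcoset_eq_iff[of H g "g \<otimes> h"] assms that by auto
  then show ?thesis
    using constant_on_double_cosets_iff[OF assms, of "\<lambda>g. sum w (g <# H)"] by simp
qed

lemma rcoset_weight_constant_iff: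
  assumes "subgroup H G"
  shows "(\<forall>g\<in>carrier G. \<forall>g'\<in>carrier G. double_coset G H g = double_coset G H g' \<longrightarrow>
             sum w (H #> g) = sum w (H #> g')) \<longleftrightarrow>
         (\<forall>h\<in>H. \<forall>g\<in>carrier G. sum w (H #> (g \<otimes> h)) = sum w (H #> g))"
proof -
  interpret H: subgroup H G by fact
  have "H #> (h \<otimes> g) = H #> g" if "h \<in> H" "g \<in> carrier G" for g h
    using repr_independence[of "h \<otimes> g" H g] rcosI[of h H g] assms that H.subset by simp
  then show ?thesis
    using constant_on_double_cosets_iff[OF assms, of "\<lambda>g. sum w (H #> g)"] by simp
qed

section \<open>Strong lumping\<close>

lemma sum_walk_matrix_lcoset:
  assumes "subgroup H G" "a \<in> carrier G" "y \<in> carrier G"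
  shows "(\<Sum>x\<in>y <# H. walk_matrix G w a x) = sum w (inv a \<otimes> y <# H) / sum w (carrier G)"
proof -
  interpret H: subgroup H G by fact
  have "sum w (inv a \<otimes> y <# H) = (\<Sum>x\<in>y <# H. w (inv a \<otimes> x))"
  proof (rule sum.reindex_bij_witness[where i = "\<lambda>x. inv a \<otimes> x" and j = "\<lambda>z. a \<otimes> z"])
  qed (use assms in \<open>auto simp: l_coset_def simp flip: m_assoc\<close>)
  then show ?thesis
    by (simp add: walk_matrix_def flip: sum_divide_distrib)
qed

lemma sum_weight_pos:
  assumes "finite (carrier G)" "weight G w"
  shows "sum w (carrier G) > 0"
proof -
  obtain g where "g \<in> carrier G" "w g > 0"
    using assms(2) by (force simp: weight_def less_le)
  then show ?thesis
    using assms by (intro sum_pos2[of _ g]) (auto simp: weight_def)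
qed

lemma walk_lumps_strongly_iff:
  assumes "finite (carrier G)" "subgroup H G" "weight G w"
  shows "walk_lumps_strongly G H w \<longleftrightarrow>
         (\<forall>h\<in>H. \<forall>g\<in>carrier G. sum w (h \<otimes> g <# H) = sum w (g <# H))"
proof -
  interpret H: subgroup H G by fact
  have "sum w (carrier G) \<noteq> 0"
    using sum_weight_pos[OF assms(1,3)] by simp
  then have lumps: "walk_lumps_strongly G H w \<longleftrightarrow>
      (\<forall>a\<in>carrier G. \<forall>a'\<in>carrier G. a <# H = a' <# H \<longrightarrow>
        (\<forall>y\<in>carrier G. sum w (inv a \<otimes> y <# H) = sum w (inv a' \<otimes> y <# H)))"
    unfolding walk_lumps_strongly_def lumps_strongly_def lcoset_map_surj[symmetric] ball_simps
    using assms(2) by (simp add: fiber_lcoset_map sum_walk_matrix_lcoset cong: ball_cong)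
  show ?thesis
  proof
    assume L: "walk_lumps_strongly G H w"
    show "\<forall>h\<in>H. \<forall>g\<in>carrier G. sum w (h \<otimes> g <# H) = sum w (g <# H)"
    proof (intro ballI)
      fix h g assume hg: "h \<in> H" "g \<in> carrier G"
      \<comment> \<open>Compare the walk started at \<open>\<one>\<close> with the one started at the point \<open>inv h\<close>
        of the same coset.\<close>
      then have "inv h <# H = \<one> <# H"
        using assms(2) by (subst lcoset_eq_iff) (auto intro!: bexI[of _ h])
      then show "sum w (h \<otimes> g <# H) = sum w (g <# H)"
        using L[unfolded lumps, rule_format, of "inv h" \<one> g] hg by simp
    qed
  next
    assume R: "\<forall>h\<in>H. \<forall>g\<in>carrier G. sum w (h \<otimes> g <# H) = sum w (g <# H)"
    show "walk_lumps_strongly G H w"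
      unfolding lumps
    proof (intro ballI impI)
      fix a a' y assume ay: "a \<in> carrier G" "a' \<in> carrier G" "y \<in> carrier G"
        and "a <# H = a' <# H"
      then obtain h where h: "h \<in> H" "a' = a \<otimes> h"
        using assms(2) by (auto simp: lcoset_eq_iff)
      then have "inv a' \<otimes> y = inv h \<otimes> (inv a \<otimes> y)"
        using ay by (simp add: inv_mult_group m_assoc)
      then show "sum w (inv a \<otimes> y <# H) = sum w (inv a' \<otimes> y <# H)"
        using R h ay by simp
    qed
  qed
qed

section \<open>Exact lumping\<close>

text \<open>The substitution of \<open>x \<otimes> h\<close> for \<open>x\<close> leaves the sum and, by invariance, the factor \<open>v x\<close>
  unchanged, but turns \<open>w (inv x \<otimes> y)\<close> into \<open>w (inv h \<otimes> inv x \<otimes> y)\<close>. Adding up over all of \<open>H\<close>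
  assembles these values into the weight of a right coset.\<close>

lemma card_times_sum_right_invariant:
  assumes "finite (carrier G)" "subgroup H G" "y \<in> carrier G"
    and inv: "\<And>x h. x \<in> carrier G \<Longrightarrow> h \<in> H \<Longrightarrow> v (x \<otimes> h) = v x"
  shows "real (card H) * (\<Sum>x\<in>carrier G. v x * w (inv x \<otimes> y)) =
         (\<Sum>x\<in>carrier G. v x * sum w (H #> (inv x \<otimes> y)))"
proof -
  interpret H: subgroup H G by fact
  have shift: "(\<Sum>x\<in>carrier G. v x * w (inv x \<otimes> y)) =
      (\<Sum>x\<in>carrier G. v x * w (h \<otimes> (inv x \<otimes> y)))" if h: "h \<in> H" for h
  proof -
    have cancel: "x \<otimes> inv h \<otimes> h = x" "x \<otimes> h \<otimes> inv h = x"
      "h \<otimes> (inv (x \<otimes> h) \<otimes> y) = inv x \<otimes> y" if "x \<in> carrier G" for x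
      using h assms(3) that by (simp_all add: m_assoc inv_mult_group, simp flip: m_assoc)
    show ?thesis
      by (rule sum.reindex_bij_witness[where i = "\<lambda>x. x \<otimes> inv h" and j = "\<lambda>x. x \<otimes> h"])
        (use h in \<open>auto simp: cancel inv\<close>)
  qed
  have "real (card H) * (\<Sum>x\<in>carrier G. v x * w (inv x \<otimes> y)) =
      (\<Sum>h\<in>H. \<Sum>x\<in>carrier G. v x * w (h \<otimes> (inv x \<otimes> y)))"
    by (simp flip: shift)
  also have "\<dots> = (\<Sum>x\<in>carrier G. v x * (\<Sum>h\<in>H. w (h \<otimes> (inv x \<otimes> y))))"
    by (subst sum.swap) (simp add: sum_distrib_left)
  also have "\<dots> = (\<Sum>x\<in>carrier G. v x * sum w (H #> (inv x \<otimes> y)))"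
    using assms(2,3) by (simp add: sum_rcoset)
  finally show ?thesis .
qed

text \<open>This is how the right coset weights become visible in the minimal space: inverting runs
  through \<open>H\<close> once more, so the points \<open>inv x \<otimes> y\<close> with \<open>x \<in> H\<close> are those of \<open>H #> y\<close>.\<close>

lemma vec_mat_uniform_on_subgroup:
  assumes "finite (carrier G)" "subgroup H G" "y \<in> carrier G"
  shows "vec_mat (carrier G) (coord_proj H (uniform_on (carrier G))) (walk_matrix G w) y =
         sum w (H #> y) / (sum w (carrier G) * real (card (carrier G)))"
proof -
  interpret H: subgroup H G by fact
  have "(\<Sum>x\<in>H. w (inv x \<otimes> y)) = (\<Sum>h\<in>H. w (h \<otimes> y))"
    by (rule sum.reindex_bij_witness[where i = "\<lambda>h. inv h" and j = "\<lambda>h. inv h"]) auto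
  then have eq: "(\<Sum>x\<in>H. w (inv x \<otimes> y)) = sum w (H #> y)"
    using assms by (simp add: sum_rcoset)
  have "vec_mat (carrier G) (coord_proj H (uniform_on (carrier G))) (walk_matrix G w) y =
      (\<Sum>x\<in>H. 1 / real (card (carrier G)) * (w (inv x \<otimes> y) / sum w (carrier G)))"
    unfolding vec_mat_def using assms
    by (auto simp: coord_proj_def uniform_on_def walk_matrix_def intro!: sum.mono_neutral_cong_right)
  also have "\<dots> = sum w (H #> y) / (sum w (carrier G) * real (card (carrier G)))"
    unfolding eq[symmetric] by (simp add: sum_divide_distrib mult.commute)
  finally show ?thesis .
qed

text \<open>Equivalently, the vectors that are constant on every left coset of \<open>H\<close>, that is, the span of
  the indicators of the fibres.\<close>

definition right_invariant_vecs :: "'a set \<Rightarrow> ('a \<Rightarrow> real) set"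
  where "right_invariant_vecs H =
    {v \<in> vecs (carrier G). \<forall>x\<in>carrier G. \<forall>h\<in>H. v (x \<otimes> h) = v x}"

text \<open>The point is stability under the walk: by the averaging identity the image of \<open>v\<close> at \<open>y\<close>
  depends on \<open>y\<close> only through the weights of the right cosets \<open>H #> (inv x \<otimes> y)\<close>, and these do not
  change when \<open>y\<close> moves within its left coset.\<close>

lemma lump_invariant_right_invariant_vecs:
  assumes "finite (carrier G)" "subgroup H G"
    and const: "\<forall>h\<in>H. \<forall>g\<in>carrier G. sum w (H #> (g \<otimes> h)) = sum w (H #> g)"
  shows "lump_invariant (carrier G) (lcosets H) (\<lambda>g. g <# H) (walk_matrix G w)
           (right_invariant_vecs H)"
proof -
  interpret H: subgroup H G by fact
  have "card H > 0"
    using assms H.one_closed by (metis H.subset card_gt_0_iff empty_iff finite_subset)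
  have mat: "vec_mat (carrier G) v (walk_matrix G w) \<in> right_invariant_vecs H"
    if v: "v \<in> right_invariant_vecs H" for v
  proof -
    define S where "S y = (\<Sum>x\<in>carrier G. v x * w (inv x \<otimes> y))" for y
    have inv: "\<And>x h. x \<in> carrier G \<Longrightarrow> h \<in> H \<Longrightarrow> v (x \<otimes> h) = v x"
      using v by (simp add: right_invariant_vecs_def)
    have avg: "real (card H) * S y = (\<Sum>x\<in>carrier G. v x * sum w (H #> (inv x \<otimes> y)))"
      if "y \<in> carrier G" for y
      unfolding S_def using card_times_sum_right_invariant[of H y v w] assms that inv by simp
    have "real (card H) * S (y \<otimes> h) = real (card H) * S y"
      if "y \<in> carrier G" "h \<in> H" for y h
    proof -
      have "(\<Sum>x\<in>carrier G. v x * sum w (H #> (inv x \<otimes> (y \<otimes> h)))) =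
          (\<Sum>x\<in>carrier G. v x * sum w (H #> (inv x \<otimes> y)))"
        using const that by (intro sum.cong) (auto simp flip: m_assoc)
      then show ?thesis
        using that by (simp add: avg)
    qed
    then have S: "S (y \<otimes> h) = S y" if "y \<in> carrier G" "h \<in> H" for y h
      using that \<open>card H > 0\<close> by simp
    have "vec_mat (carrier G) v (walk_matrix G w) =
        (\<lambda>y. if y \<in> carrier G then S y / sum w (carrier G) else 0)"
      by (simp add: vec_mat_def walk_matrix_def S_def sum_divide_distrib cong: if_cong)
    then show ?thesis
      using S by (simp add: right_invariant_vecs_def vecs_def)
  qed
  have proj: "coord_proj (fiber (carrier G) (\<lambda>g. g <# H) b) v \<in> right_invariant_vecs H"
    if v: "v \<in> right_invariant_vecs H" for v b
  proof -
    have "x \<otimes> h <# H = x <# H" if "x \<in> carrier G" "h \<in> H" for x h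
      using lcoset_eq_iff[of H x "x \<otimes> h"] assms that by auto
    then show ?thesis
      using v by (auto simp: right_invariant_vecs_def coord_proj_def fiber_def vecs_def)
  qed
  have "fun_vs.subspace (right_invariant_vecs H)"
    by (auto simp: fun_vs.subspace_def right_invariant_vecs_def vecs_def fun_scale_def)
  then show ?thesis
    using mat proj by (auto simp: lump_invariant_def right_invariant_vecs_def)
qed

text \<open>Necessity tests exact lumping on one explicit vector \<open>d\<close> of the minimal space for each coset
  \<open>gH\<close>; sufficiency bounds the minimal space by the vectors constant on left cosets, on which the
  coset sums are injective.\<close>

lemma walk_lumps_exactly_iff:
  assumes "finite (carrier G)" "subgroup H G" "weight G w"
  shows "walk_lumps_exactly G H w \<longleftrightarrow>
         (\<forall>h\<in>H. \<forall>g\<in>carrier G. sum w (H #> (g \<otimes> h)) = sum w (H #> g))"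
    (is "_ \<longleftrightarrow> ?const")
proof -
  interpret H: subgroup H G by fact
  have pos: "sum w (carrier G) > 0"
    using assms sum_weight_pos by blast
  have cardG: "card (carrier G) > 0"
    using assms(1) card_gt_0_iff by blast
  have finH: "finite H"
    using assms(1) H.subset finite_subset by blast
  have cardH: "card H > 0"
    using finH H.one_closed card_gt_0_iff by blast
  have card_lcoset: "card (y <# H) = card H" if "y \<in> carrier G" for y
  proof -
    have "y <# H = (\<lambda>h. y \<otimes> h) ` H"
      by (auto simp: l_coset_def)
    then show ?thesis
      using that by (simp add: card_image inj_on_def)
  qed
  define \<eta> where "\<eta> = uniform_on (carrier G)"
  define P where "P = walk_matrix G w"
  define V where "V = lump_space (carrier G) (lcosets H) (\<lambda>g. g <# H) P \<eta>"
  have eta: "\<eta> \<in> vecs (carrier G)"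
    by (simp add: \<eta>_def uniform_on_def vecs_def)
  have exact: "walk_lumps_exactly G H w \<longleftrightarrow>
      (\<forall>v\<in>V. (\<forall>y\<in>carrier G. (\<Sum>a\<in>y <# H. v a) = 0) \<longrightarrow> v = 0)"
    unfolding walk_lumps_exactly_def lumps_exactly_def V_def P_def \<eta>_def
      lcoset_map_surj[symmetric] ball_simps
    using assms by (simp add: fiber_lcoset_map)
  show ?thesis
  proof
    assume lumps: "walk_lumps_exactly G H w"
    have V: "fun_vs.subspace V" "\<And>v. v \<in> V \<Longrightarrow> vec_mat (carrier G) v P \<in> V" "\<eta> \<in> V"
      "\<And>v y. v \<in> V \<Longrightarrow> y \<in> carrier G \<Longrightarrow> coord_proj (y <# H) v \<in> V"
      using lump_space_least(1,2)[OF eta, of "lcosets H" "\<lambda>g. g <# H" P] assms(2) fiber_lcoset_map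
      unfolding lump_invariant_def V_def by (force simp flip: lcoset_map_surj)+
    show ?const
    proof (intro ballI)
      fix h g assume h: "h \<in> H" and g: "g \<in> carrier G"
      define C where "C = g <# H"
      have C: "C \<subseteq> carrier G" "g \<in> C" "g \<otimes> h \<in> C"
        using g h lcos_self[OF g assms(2)] unfolding C_def by (auto simp: l_coset_def)
      define u where "u = coord_proj C (vec_mat (carrier G) (coord_proj H \<eta>) P)"
      \<comment> \<open>The entries of \<open>\<eta>\<close> are \<open>1 / card (carrier G)\<close>, so \<open>c\<close> makes the subtracted vector
        equal on \<open>C\<close> to the mean of \<open>u\<close>, and \<open>d\<close> sums to zero over \<open>C\<close>.\<close>
      define c where "c = real (card (carrier G)) * (\<Sum>a\<in>C. u a) / real (card H)"
      define d where "d = u - fun_scale c (coord_proj C \<eta>)"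
      have "\<one> <# H = H"
        using H.subset by (auto simp: l_coset_def)
      then have "u \<in> V" "coord_proj C \<eta> \<in> V"
        using V(2-4) g one_closed unfolding u_def C_def by metis+
      then have "d \<in> V"
        unfolding d_def using V(1) by (simp add: fun_vs.subspace_diff fun_vs.subspace_scale)
      have d_in: "d a = u a - c / real (card (carrier G))" if "a \<in> C" for a
        using that C by (auto simp: d_def fun_scale_def coord_proj_def \<eta>_def uniform_on_def)
      have d_out: "d a = 0" if "a \<notin> C" for a
        using that by (simp add: d_def u_def fun_scale_def coord_proj_def)
      have "(\<Sum>a\<in>y <# H. d a) = 0" if y: "y \<in> carrier G" for y
      proof (cases "y <# H = C")
        case True
        then show ?thesis
          using card_lcoset[OF g] cardH cardG by (simp add: d_in sum_subtractf C_def c_def)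
      next
        case False
        then have "a \<notin> C" if "a \<in> y <# H" for a
          using that l_repr_independence[OF _ y assms(2)] l_repr_independence[OF _ g assms(2)]
          unfolding C_def by metis
        then show ?thesis
          by (simp add: d_out)
      qed
      then have "d = 0"
        using lumps \<open>d \<in> V\<close> by (simp add: exact)
      then have "u (g \<otimes> h) = u g"
        using d_in[OF C(2)] d_in[OF C(3)] by simp
      then show "sum w (H #> (g \<otimes> h)) = sum w (H #> g)"
        using C g h pos carrier_not_empty assms(1,2)
        by (simp add: u_def coord_proj_def[of C] P_def \<eta>_def vec_mat_uniform_on_subgroup)
    qed
  next
    assume const: ?const
    have "\<eta> \<in> right_invariant_vecs H"
      using eta by (simp add: right_invariant_vecs_def \<eta>_def uniform_on_def)
    then have sub: "V \<subseteq> right_invariant_vecs H"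
      unfolding V_def P_def
      using lump_space_least(3)[OF eta] lump_invariant_right_invariant_vecs[OF assms(1,2) const]
      by blast
    have "v = 0" if "v \<in> V" and zero: "\<forall>y\<in>carrier G. (\<Sum>a\<in>y <# H. v a) = 0" for v
    proof
      fix y
      have v: "v \<in> vecs (carrier G)" "\<And>x h. x \<in> carrier G \<Longrightarrow> h \<in> H \<Longrightarrow> v (x \<otimes> h) = v x"
        using sub that(1) by (auto simp: right_invariant_vecs_def)
      show "v y = 0 y"
      proof (cases "y \<in> carrier G")
        case True
        then have "v a = v y" if "a \<in> y <# H" for a
          using that v(2) by (auto simp: l_coset_def)
        then have "(\<Sum>a\<in>y <# H. v a) = real (card H) * v y"
          using card_lcoset[OF True] by simp
        then show ?thesis
          using zero True cardH by simp
      next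
        case False
        then show ?thesis
          using v(1) by (simp add: vecs_def)
      qed
    qed
    then show "walk_lumps_exactly G H w"
      unfolding exact by blast
  qed
qed

end

theorem corollary1p10:
  fixes G :: "('a, 'c) monoid_scheme" (structure)
    and H :: "'a set" and w :: "'a \<Rightarrow> real"
  assumes "group G" and "finite (carrier G)" and "subgroup H G" and "weight G w"
  shows "(walk_lumps_strongly G H w \<longleftrightarrow>
           (\<forall>g\<in>carrier G. \<forall>g'\<in>carrier G. double_coset G H g = double_coset G H g' \<longrightarrow>
              sum w (g <# H) = sum w (g' <# H))) \<and>
         (walk_lumps_exactly G H w \<longleftrightarrow>
           (\<forall>g\<in>carrier G. \<forall>g'\<in>carrier G. double_coset G H g = double_coset G H g' \<longrightarrow>
              sum w (H #> g) = sum w (H #> g')))"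
proof -
  interpret group G by fact
  show ?thesis
    using assms(2-4)
    by (simp only: walk_lumps_strongly_iff walk_lumps_exactly_iff
        lcoset_weight_constant_iff rcoset_weight_constant_iff)
qed

end
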